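(* Let $D$ be a Prüfer domain with quotient field $K$ and let $E$ be a nonempty subset of $K$. Then $\mathrm{Int}^{\mathrm R}(E,D)$ is faithfully flat as a $D$-module.
   Context: $\mathrm{Int}^{\mathrm R}(E,D):=\{f\in K(X);\ f(E)\subseteq D\}$, where $f(E)\subseteq D$ means that for every $e\in E$ the rational function $f$ is defined at $e$ and $f(e)\in D$. It is a $D$-algebra containing $D$ as constant functions. *)

theory Defs
  imports "HOL-Algebra.Algebra" "HOL-Algebra.Algebraic_Closure_Type"
begin

section \<open>Domains inside a field\<close>

text \<open>
  The field \<open>K\<close> is the whole type \<open>'k\<close>, and a domain with quotient field \<open>K\<close> is a subring
  \<open>D\<close> of it that satisfies \<open>has_quotient_field D\<close>.
\<close>

definition ring_on :: "'k::field set \<Rightarrow> 'k ring" where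
  "ring_on D = ring_of_type_algebra\<lparr>carrier := D\<rparr>"

definition has_quotient_field :: "'k::field set \<Rightarrow> bool" where
  "has_quotient_field D \<longleftrightarrow> (\<forall>x. \<exists>a\<in>D. \<exists>b\<in>D. b \<noteq> 0 \<and> x = a / b)"

definition field_module :: "('k::field, 'k) module" where
  "field_module =
     \<lparr>carrier = UNIV, monoid.mult = (*), one = 1, ring.zero = 0, add = (+),
      module.smult = (*)\<rparr>"

definition fractional_ideal :: "'k::field set \<Rightarrow> 'k set \<Rightarrow> bool" where
  "fractional_ideal D J \<longleftrightarrow>
     submodule J (ring_on D) field_module \<and> (\<exists>d\<in>D. d \<noteq> 0 \<and> (\<forall>x\<in>J. d * x \<in> D))"

definition invertible_ideal :: "'k::field set \<Rightarrow> 'k set \<Rightarrow> bool" where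
  "invertible_ideal D I \<longleftrightarrow>
     fractional_ideal D I \<and>
     (\<exists>J. fractional_ideal D J \<and> ideal_prod ring_of_type_algebra I J = D)"

text \<open>
  Fractional ideals have a common denominator in \<open>D\<close>, so they lie in the quotient field of \<open>D\<close>
  even when that is smaller than \<open>'k\<close>; hence this notion does not depend on the ambient field.
\<close>

definition prufer_domain :: "'k::field set \<Rightarrow> bool" where
  "prufer_domain D \<longleftrightarrow>
     subdomain D ring_of_type_algebra \<and>
     (\<forall>I. (\<exists>A. finite A \<and> A \<subseteq> D \<and> I = genideal (ring_on D) A) \<and> I \<noteq> {0} \<longrightarrow>
        invertible_ideal D I)"


section \<open>Integer-valued rational functions\<close>

text \<open>
  \<open>K(X)\<close> is \<open>'k poly fract\<close>. A rational function is defined at \<open>e\<close> if one of its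
  representations as a fraction has a denominator that does not vanish at \<open>e\<close>.
  (\<open>Fract p 0\<close> is \<open>0\<close>, but the zero polynomial vanishes at every \<open>e\<close>.)
\<close>

definition rat_defined_at :: "'k::field poly fract \<Rightarrow> 'k \<Rightarrow> bool" where
  "rat_defined_at f e \<longleftrightarrow> (\<exists>p q. f = Fract p q \<and> poly q e \<noteq> 0)"

definition rat_eval :: "'k::field poly fract \<Rightarrow> 'k \<Rightarrow> 'k" where
  "rat_eval f e = (THE v. \<exists>p q. f = Fract p q \<and> poly q e \<noteq> 0 \<and> v = poly p e / poly q e)"

lemma rat_eval_Fract:
  assumes "poly q e \<noteq> 0"
  shows "rat_eval (Fract p q) e = poly p e / poly q e"
  unfolding rat_eval_def
proof (rule the_equality)
  fix v
  assume "\<exists>p' q'. Fract p q = Fract p' q' \<and> poly q' e \<noteq> 0 \<and> v = poly p' e / poly q' e"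
  then obtain p' q' where *: "Fract p q = Fract p' q'" "poly q' e \<noteq> 0" "v = poly p' e / poly q' e"
    by blast
  have "q \<noteq> 0" "q' \<noteq> 0"
    using assms *(2) by auto
  with *(1) have "p * q' = p' * q"
    by (simp add: eq_fract(1))
  then have "poly p e * poly q' e = poly p' e * poly q e"
    by (metis poly_mult)
  then show "v = poly p e / poly q e"
    using assms *(2,3) by (simp add: frac_eq_eq)
qed (use assms in blast)

definition int_rat :: "'k::field set \<Rightarrow> 'k set \<Rightarrow> 'k poly fract set" where
  "int_rat E D = {f. \<forall>e\<in>E. rat_defined_at f e \<and> rat_eval f e \<in> D}"

definition int_rat_algebra :: "'k::field set \<Rightarrow> 'k set \<Rightarrow> ('k, 'k poly fract) module" where
  "int_rat_algebra E D =
     \<lparr>carrier = int_rat E D, monoid.mult = (*), one = 1, ring.zero = 0, add = (+),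
      module.smult = (\<lambda>d f. Fract [:d:] 1 * f)\<rparr>"


section \<open>Tensor products and faithful flatness\<close>

definition linear_map ::
  "('r, 'm) ring_scheme \<Rightarrow> ('r, 'a) module \<Rightarrow> ('r, 'b) module \<Rightarrow> ('a \<Rightarrow> 'b) \<Rightarrow> bool" where
  "linear_map R N N' g \<longleftrightarrow>
     g \<in> hom (add_monoid N) (add_monoid N') \<and>
     (\<forall>r\<in>carrier R. \<forall>x\<in>carrier N. g (r \<odot>\<^bsub>N\<^esub> x) = r \<odot>\<^bsub>N'\<^esub> g x)"

definition exact_at ::
  "('a, 'm) monoid_scheme \<Rightarrow> ('b, 'n) monoid_scheme \<Rightarrow> ('c, 'o) monoid_scheme \<Rightarrow>
   ('a \<Rightarrow> 'b) \<Rightarrow> ('b \<Rightarrow> 'c) \<Rightarrow> bool" where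
  "exact_at G1 G2 G3 f g \<longleftrightarrow> f ` carrier G1 = kernel G2 G3 g"

text \<open>
  The tensor product over \<open>R\<close> of \<open>M\<close> and \<open>N\<close> is the free abelian group on \<open>M \<times> N\<close> modulo the
  subgroup generated by the bilinearity relations. Only its group structure is constructed, since
  exactness of a sequence of modules is exactness of the underlying abelian groups.
\<close>

definition tensor_relators ::
  "('r, 'm) ring_scheme \<Rightarrow> ('r, 'a) module \<Rightarrow> ('r, 'b) module \<Rightarrow> ('a \<times> 'b \<Rightarrow>\<^sub>0 int) set" where
  "tensor_relators R M N =
     {frag_of (x \<oplus>\<^bsub>M\<^esub> x', y) - frag_of (x, y) - frag_of (x', y) | x x' y.
        x \<in> carrier M \<and> x' \<in> carrier M \<and> y \<in> carrier N} \<union>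
     {frag_of (x, y \<oplus>\<^bsub>N\<^esub> y') - frag_of (x, y) - frag_of (x, y') | x y y'.
        x \<in> carrier M \<and> y \<in> carrier N \<and> y' \<in> carrier N} \<union>
     {frag_of (r \<odot>\<^bsub>M\<^esub> x, y) - frag_of (x, r \<odot>\<^bsub>N\<^esub> y) | r x y.
        r \<in> carrier R \<and> x \<in> carrier M \<and> y \<in> carrier N}"

definition tensor_relations ::
  "('r, 'm) ring_scheme \<Rightarrow> ('r, 'a) module \<Rightarrow> ('r, 'b) module \<Rightarrow> ('a \<times> 'b \<Rightarrow>\<^sub>0 int) set" where
  "tensor_relations R M N =
     generate (free_Abelian_group (carrier M \<times> carrier N)) (tensor_relators R M N)"

definition tensor_product ::
  "('r, 'm) ring_scheme \<Rightarrow> ('r, 'a) module \<Rightarrow> ('r, 'b) module \<Rightarrow> ('a \<times> 'b \<Rightarrow>\<^sub>0 int) set monoid" where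
  "tensor_product R M N =
     free_Abelian_group (carrier M \<times> carrier N) Mod tensor_relations R M N"

text \<open>
  The map \<open>id \<otimes> g\<close>: all representatives \<open>z\<close> of a coset \<open>C\<close> yield the same coset, so the image
  of \<open>C\<close> below is a singleton.
\<close>

definition tensor_map ::
  "('r, 'm) ring_scheme \<Rightarrow> ('r, 'a) module \<Rightarrow> ('r, 'c) module \<Rightarrow>
   ('b \<Rightarrow> 'c) \<Rightarrow> ('a \<times> 'b \<Rightarrow>\<^sub>0 int) set \<Rightarrow> ('a \<times> 'c \<Rightarrow>\<^sub>0 int) set" where
  "tensor_map R M N' g C =
     the_elem ((\<lambda>z. tensor_relations R M N'
                  #>\<^bsub>free_Abelian_group (carrier M \<times> carrier N')\<^esub>
                  frag_extend (\<lambda>(x, y). frag_of (x, g y)) z) ` C)"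

text \<open>
  \<open>M\<close> is faithfully flat if a sequence \<open>N1 \<rightarrow> N2 \<rightarrow> N3\<close> of modules is exact if and only if it is
  exact after tensoring with \<open>M\<close>. The first argument only names the types of the elements of
  \<open>N1\<close>, \<open>N2\<close>, \<open>N3\<close>; a theorem in which these are type variables covers all modules.
\<close>

definition faithfully_flat ::
  "('n1 \<times> 'n2 \<times> 'n3) itself \<Rightarrow> ('r, 'm) ring_scheme \<Rightarrow> ('r, 'a) module \<Rightarrow> bool" where
  "faithfully_flat T R M \<longleftrightarrow>
     module R M \<and>
     (\<forall>(N1 :: ('r, 'n1) module) (N2 :: ('r, 'n2) module) (N3 :: ('r, 'n3) module) g h.
        module R N1 \<and> module R N2 \<and> module R N3 \<and> linear_map R N1 N2 g \<and> linear_map R N2 N3 h \<longrightarrow>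
        (exact_at (add_monoid N1) (add_monoid N2) (add_monoid N3) g h \<longleftrightarrow>
         exact_at (tensor_product R M N1) (tensor_product R M N2) (tensor_product R M N3)
           (tensor_map R M N2 g) (tensor_map R M N3 h)))"

end

theory Submission
  imports Defs
begin

text \<open>
  Write \<open>M\<close> for the module of integer-valued rational functions on \<open>E\<close>.

  Faithfulness is easy: evaluation at a point \<open>e \<in> E\<close> is a \<open>D\<close>-linear map \<open>M \<rightarrow> D\<close> that sends the
  constant \<open>1\<close> to \<open>1\<close>, so every \<open>D\<close>-module \<open>N\<close> is a natural retract of \<open>M \<otimes> N\<close>. An exact tensored
  sequence therefore has the original sequence as an exact retract (\<open>exact_if_tensor_exact\<close>).

  Flatness holds because \<open>M\<close> is torsion-free, being contained in the \<open>K\<close>-vector space \<open>K(X)\<close>, and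
  torsion-free modules over a Pruefer domain are flat. The proof is by equations. If
  \<open>\<Sum>i. c\<^sub>i x\<^sub>i = 0\<close> with \<open>c\<^sub>i \<in> D\<close> not all zero, the ideal generated by the \<open>c\<^sub>i\<close> is invertible, so
  there are \<open>s\<^sub>i\<close> with \<open>\<Sum>i. c\<^sub>i s\<^sub>i = 1\<close> and all \<open>s\<^sub>i c\<^sub>j \<in> D\<close>. The matrix
  \<open>A\<^sub>i\<^sub>j = \<delta>\<^sub>i\<^sub>j - s\<^sub>i c\<^sub>j\<close> over \<open>D\<close> satisfies \<open>A x = x\<close> and \<open>c A = 0\<close> (\<open>kill_relation\<close>), and products
  of such matrices deal with finitely many relations at once (\<open>kill_relations\<close>). Hence finitely
  many elements of \<open>M\<close> have coordinates in \<open>D\<close> that respect any prescribed finite set of relations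
  (\<open>factors_through_free\<close>), which is Lazard's criterion. A tensor in the kernel of \<open>id \<otimes> h\<close> is
  zero in the target because of finitely many bilinearity relations; coordinates that respect
  these move the tensor into the image of \<open>id \<otimes> g\<close> (\<open>tensor_exact_if_exact\<close>).
\<close>


section \<open>The relations of a tensor product\<close>

text \<open>
  \<open>formal_sums\<close> is the free abelian group on \<open>M \<times> N\<close>, and \<open>relations\<close> is the subgroup that is
  divided out to form \<open>M \<otimes> N\<close>. Elements of the tensor product are handled through their
  representatives, so that \<open>u - v \<in> relations\<close> says that \<open>u\<close> and \<open>v\<close> represent the same tensor.
\<close>

locale tensor_factors =
  M: module R M + N: module R N
  for R :: "('r, 'm) ring_scheme" (structure)
    and M :: "('r, 'a) module" and N :: "('r, 'b) module"
begin

abbreviation "formal_sums \<equiv> free_Abelian_group (carrier M \<times> carrier N)"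

abbreviation "relations \<equiv> tensor_relations R M N"

lemma tensor_relators_subset: "tensor_relators R M N \<subseteq> carrier formal_sums"
  unfolding tensor_relators_def
  by (auto simp: subset_iff dest!: subsetD[OF keys_diff])

sublocale relations: subgroup relations formal_sums
  unfolding tensor_relations_def
  by (rule group.generate_is_subgroup[OF group_free_Abelian_group tensor_relators_subset])

lemma relations_keys: "u \<in> relations \<Longrightarrow> Poly_Mapping.keys u \<subseteq> carrier M \<times> carrier N"
  using relations.mem_carrier by simp

lemma relations_0: "0 \<in> relations"
  using relations.one_closed by simp

lemma relations_add: "u \<in> relations \<Longrightarrow> v \<in> relations \<Longrightarrow> u + v \<in> relations"
  using relations.m_closed by simp

lemma relations_minus: "u \<in> relations \<Longrightarrow> - u \<in> relations"
  using relations.m_inv_closed relations_keys by fastforce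

lemma relations_diff: "u \<in> relations \<Longrightarrow> v \<in> relations \<Longrightarrow> u - v \<in> relations"
  using relations_add[of u "- v"] relations_minus by simp

lemma relations_sum: "(\<And>i. i \<in> I \<Longrightarrow> f i \<in> relations) \<Longrightarrow> sum f I \<in> relations"
  by (induction I rule: infinite_finite_induct) (auto intro: relations_0 relations_add)

lemma relations_relator: "u \<in> tensor_relators R M N \<Longrightarrow> u \<in> relations"
  unfolding tensor_relations_def by (rule generate.incl)

lemma relations_add_left:
  "\<lbrakk>x \<in> carrier M; x' \<in> carrier M; y \<in> carrier N\<rbrakk>
    \<Longrightarrow> frag_of (x \<oplus>\<^bsub>M\<^esub> x', y) - frag_of (x, y) - frag_of (x', y) \<in> relations"
  by (rule relations_relator) (auto simp: tensor_relators_def)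

lemma relations_add_right:
  "\<lbrakk>x \<in> carrier M; y \<in> carrier N; y' \<in> carrier N\<rbrakk>
    \<Longrightarrow> frag_of (x, y \<oplus>\<^bsub>N\<^esub> y') - frag_of (x, y) - frag_of (x, y') \<in> relations"
  by (rule relations_relator) (auto simp: tensor_relators_def)

lemma relations_smult:
  "\<lbrakk>r \<in> carrier R; x \<in> carrier M; y \<in> carrier N\<rbrakk>
    \<Longrightarrow> frag_of (r \<odot>\<^bsub>M\<^esub> x, y) - frag_of (x, r \<odot>\<^bsub>N\<^esub> y) \<in> relations"
  by (rule relations_relator) (auto simp: tensor_relators_def)

lemma relations_zero_left: "y \<in> carrier N \<Longrightarrow> frag_of (\<zero>\<^bsub>M\<^esub>, y) \<in> relations"
  using relations_add_left[of "\<zero>\<^bsub>M\<^esub>" "\<zero>\<^bsub>M\<^esub>" y] relations_minus by fastforce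

lemma relations_zero_right: "x \<in> carrier M \<Longrightarrow> frag_of (x, \<zero>\<^bsub>N\<^esub>) \<in> relations"
  using relations_add_right[of x "\<zero>\<^bsub>N\<^esub>" "\<zero>\<^bsub>N\<^esub>"] relations_minus by fastforce

lemma relations_diff_right:
  assumes "x \<in> carrier M" "y \<in> carrier N" "y' \<in> carrier N"
  shows "frag_of (x, y \<ominus>\<^bsub>N\<^esub> y') - (frag_of (x, y) - frag_of (x, y')) \<in> relations"
proof -
  have "y \<ominus>\<^bsub>N\<^esub> y' \<oplus>\<^bsub>N\<^esub> y' = y"
    using assms by (simp add: a_minus_def N.a_assoc N.l_neg)
  then have "frag_of (x, y) - frag_of (x, y \<ominus>\<^bsub>N\<^esub> y') - frag_of (x, y') \<in> relations"
    using relations_add_right[of x "y \<ominus>\<^bsub>N\<^esub> y'" y'] assms by simp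
  from relations_minus[OF this] show ?thesis
    by (simp add: algebra_simps)
qed

lemma relations_finsum_left:
  assumes "finite T" "f \<in> T \<rightarrow> carrier M" "y \<in> carrier N"
  shows "frag_of (finsum M f T, y) - (\<Sum>j\<in>T. frag_of (f j, y)) \<in> relations"
  using assms
proof (induction T rule: finite_induct)
  case empty
  then show ?case
    by (simp add: relations_zero_left)
next
  case (insert j T)
  have [simp]: "f j \<in> carrier M" "finsum M f T \<in> carrier M"
    using insert.prems by auto
  have "frag_of (f j \<oplus>\<^bsub>M\<^esub> finsum M f T, y) - frag_of (f j, y) - frag_of (finsum M f T, y)
     + (frag_of (finsum M f T, y) - (\<Sum>j\<in>T. frag_of (f j, y))) \<in> relations"
    using insert by (intro relations_add relations_add_left) auto
  then show ?case
    using insert by (simp add: algebra_simps)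
qed

lemma relations_induct [consumes 1, case_names relator zero add minus]:
  assumes "u \<in> relations"
    and relator: "\<And>u. u \<in> tensor_relators R M N \<Longrightarrow> P u"
    and zero: "P 0"
    and add: "\<And>u v. u \<in> relations \<Longrightarrow> v \<in> relations \<Longrightarrow> P u \<Longrightarrow> P v \<Longrightarrow> P (u + v)"
    and minus: "\<And>u. u \<in> relations \<Longrightarrow> P u \<Longrightarrow> P (- u)"
  shows "P u"
proof -
  have "u \<in> generate formal_sums (tensor_relators R M N)"
    using assms(1) by (simp add: tensor_relations_def)
  then show ?thesis
  proof (induction rule: generate.induct)
    case (inv v)
    then show ?case
      using minus[of v] relator relations_relator relations_keys by simp
  next
    case (eng v w)
    then show ?case
      using add[of v w] by (simp add: tensor_relations_def)
  qed (use relator zero in simp_all)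
qed

lemma relations_coset:
  "relations #>\<^bsub>formal_sums\<^esub> u = {v. v - u \<in> relations}"
  by (auto simp: r_coset_def)

lemma relations_coset_eq_iff:
  "relations #>\<^bsub>formal_sums\<^esub> u = relations #>\<^bsub>formal_sums\<^esub> v \<longleftrightarrow> u - v \<in> relations"
proof
  assume "relations #>\<^bsub>formal_sums\<^esub> u = relations #>\<^bsub>formal_sums\<^esub> v"
  moreover have "u \<in> relations #>\<^bsub>formal_sums\<^esub> u"
    using relations_0 by (simp add: relations_coset)
  ultimately show "u - v \<in> relations"
    by (simp add: relations_coset)
next
  assume uv: "u - v \<in> relations"
  have "w - u \<in> relations \<longleftrightarrow> w - v \<in> relations" for w
    using relations_add[OF _ uv, of "w - u"] relations_diff[OF _ uv, of "w - v"] by auto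
  then show "relations #>\<^bsub>formal_sums\<^esub> u = relations #>\<^bsub>formal_sums\<^esub> v"
    by (simp add: relations_coset)
qed

lemma relations_coset_0: "relations #>\<^bsub>formal_sums\<^esub> 0 = relations"
  by (simp add: relations_coset)

lemma carrier_tensor_product:
  "carrier (tensor_product R M N) = (\<lambda>z. relations #>\<^bsub>formal_sums\<^esub> z) ` carrier formal_sums"
  by (auto simp: tensor_product_def FactGroup_def RCOSETS_def)

lemma one_tensor_product: "\<one>\<^bsub>tensor_product R M N\<^esub> = relations"
  by (simp add: tensor_product_def FactGroup_def)

end


section \<open>Induced maps and exactness in terms of representatives\<close>

text \<open>
  The map \<open>id \<otimes> g\<close> on representatives.
\<close>

definition formal_map :: "('b \<Rightarrow> 'c) \<Rightarrow> ('a \<times> 'b \<Rightarrow>\<^sub>0 int) \<Rightarrow> ('a \<times> 'c \<Rightarrow>\<^sub>0 int)" where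
  "formal_map g = frag_extend (\<lambda>(x, y). frag_of (x, g y))"

lemma formal_map_simps:
  "formal_map g 0 = 0"
  "formal_map g (frag_of (x, y)) = frag_of (x, g y)"
  "formal_map g (u + v) = formal_map g u + formal_map g v"
  "formal_map g (u - v) = formal_map g u - formal_map g v"
  "formal_map g (- u) = - formal_map g u"
  by (simp_all add: formal_map_def frag_extend_add frag_extend_diff frag_extend_minus)

lemma formal_map_sum: "formal_map g (sum f I) = (\<Sum>i\<in>I. formal_map g (f i))"
  by (induction I rule: infinite_finite_induct) (simp_all add: formal_map_simps)

lemma formal_map_keys:
  assumes "Poly_Mapping.keys z \<subseteq> A \<times> B" "g ` B \<subseteq> C"
  shows "Poly_Mapping.keys (formal_map g z) \<subseteq> A \<times> C"
  using assms(1)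
proof (induction z rule: frag_induction)
  case (diff u v)
  then show ?case
    using keys_diff[of "formal_map g u" "formal_map g v"] by (auto simp: formal_map_simps)
qed (use assms(2) in \<open>auto simp: formal_map_simps\<close>)

text \<open>
  A linear map \<open>g : N \<rightarrow> N'\<close> together with the module \<open>M\<close> by which it is tensored.
\<close>

locale tensored_map =
  N: tensor_factors R M N + N': tensor_factors R M N'
  for R :: "('r, 'm) ring_scheme" (structure)
    and M :: "('r, 'a) module" and N :: "('r, 'b) module" and N' :: "('r, 'c) module" +
  fixes g
  assumes linear: "linear_map R N N' g"
begin

lemma map_closed: "x \<in> carrier N \<Longrightarrow> g x \<in> carrier N'"
  using linear by (auto simp: linear_map_def hom_def)

lemma map_add: "x \<in> carrier N \<Longrightarrow> y \<in> carrier N \<Longrightarrow> g (x \<oplus>\<^bsub>N\<^esub> y) = g x \<oplus>\<^bsub>N'\<^esub> g y"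
  using linear by (auto simp: linear_map_def hom_def)

lemma map_smult: "r \<in> carrier R \<Longrightarrow> x \<in> carrier N \<Longrightarrow> g (r \<odot>\<^bsub>N\<^esub> x) = r \<odot>\<^bsub>N'\<^esub> g x"
  using linear by (auto simp: linear_map_def)

lemma formal_map_closed:
  "z \<in> carrier N.formal_sums \<Longrightarrow> formal_map g z \<in> carrier N'.formal_sums"
  using formal_map_keys[of z "carrier M" "carrier N" g "carrier N'"] map_closed by auto

lemma formal_map_relations:
  assumes "u \<in> N.relations"
  shows "formal_map g u \<in> N'.relations"
  using assms
proof (induction rule: N.relations_induct)
  case (relator u)
  then have "formal_map g u \<in> tensor_relators R M N'"
    unfolding tensor_relators_def
    by (auto simp: formal_map_simps map_add map_smult) (metis map_closed)+
  then show ?case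
    by (rule N'.relations_relator)
qed (simp_all add: formal_map_simps N'.relations_0 N'.relations_add N'.relations_minus)

lemma tensor_map_coset:
  "tensor_map R M N' g (N.relations #>\<^bsub>N.formal_sums\<^esub> z)
     = N'.relations #>\<^bsub>N'.formal_sums\<^esub> formal_map g z"
proof -
  have "N'.relations #>\<^bsub>N'.formal_sums\<^esub> formal_map g w
      = N'.relations #>\<^bsub>N'.formal_sums\<^esub> formal_map g z"
    if "w \<in> N.relations #>\<^bsub>N.formal_sums\<^esub> z" for w
    using that formal_map_relations[of "w - z"]
    by (simp add: N.relations_coset N'.relations_coset_eq_iff formal_map_simps)
  moreover have "z \<in> N.relations #>\<^bsub>N.formal_sums\<^esub> z"
    by (simp add: N.relations_coset N.relations_0)
  ultimately have "(\<lambda>w. N'.relations #>\<^bsub>N'.formal_sums\<^esub> formal_map g w)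
      ` (N.relations #>\<^bsub>N.formal_sums\<^esub> z) = {N'.relations #>\<^bsub>N'.formal_sums\<^esub> formal_map g z}"
    by blast
  then show ?thesis
    by (simp add: tensor_map_def formal_map_def)
qed

end

lemma image_eq_image_Collect_iff:
  assumes "\<And>w. w \<in> A \<Longrightarrow> f w \<in> B" "\<And>z z'. c z = c z' \<Longrightarrow> P z' \<Longrightarrow> P z"
  shows "(\<lambda>w. c (f w)) ` A = c ` {z \<in> B. P z} \<longleftrightarrow>
    (\<forall>w\<in>A. P (f w)) \<and> (\<forall>z\<in>B. P z \<longrightarrow> (\<exists>w\<in>A. c z = c (f w)))"
proof safe
  fix w
  assume "(\<lambda>w. c (f w)) ` A = c ` {z \<in> B. P z}" "w \<in> A"
  then have "c (f w) \<in> c ` {z \<in> B. P z}"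
    by blast
  then show "P (f w)"
    using assms(2) by auto
next
  fix z
  assume "(\<lambda>w. c (f w)) ` A = c ` {z \<in> B. P z}" "z \<in> B" "P z"
  then have "c z \<in> (\<lambda>w. c (f w)) ` A"
    by blast
  then show "\<exists>w\<in>A. c z = c (f w)"
    by blast
qed (use assms(1) in auto)

locale tensor_sequence =
  g: tensored_map R M N1 N2 g + h: tensored_map R M N2 N3 h
  for R :: "('r, 'm) ring_scheme" (structure)
    and M :: "('r, 'a) module" and N1 :: "('r, 'b) module" and N2 :: "('r, 'c) module"
    and N3 :: "('r, 'd) module" and g h
begin

lemma exact_at_iff:
  "exact_at (add_monoid N1) (add_monoid N2) (add_monoid N3) g h \<longleftrightarrow>
     (\<forall>x\<in>carrier N1. h (g x) = \<zero>\<^bsub>N3\<^esub>) \<and>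
     (\<forall>y\<in>carrier N2. h y = \<zero>\<^bsub>N3\<^esub> \<longrightarrow> (\<exists>x\<in>carrier N1. y = g x))"
  using g.map_closed by (auto simp: exact_at_def kernel_def)

text \<open>
  Exactness of the tensored sequence, expressed without cosets.
\<close>

lemma exact_at_tensor_iff:
  "exact_at (tensor_product R M N1) (tensor_product R M N2) (tensor_product R M N3)
       (tensor_map R M N2 g) (tensor_map R M N3 h) \<longleftrightarrow>
     (\<forall>w\<in>carrier g.N.formal_sums. formal_map h (formal_map g w) \<in> h.N'.relations) \<and>
     (\<forall>z\<in>carrier g.N'.formal_sums. formal_map h z \<in> h.N'.relations \<longrightarrow>
        (\<exists>w\<in>carrier g.N.formal_sums. z - formal_map g w \<in> g.N'.relations))"
  (is "?exact \<longleftrightarrow> ?rep")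
proof -
  let ?c = "\<lambda>z. g.N'.relations #>\<^bsub>g.N'.formal_sums\<^esub> z"
  let ?F = "carrier g.N.formal_sums" and ?G = "carrier g.N'.formal_sums"
  have im: "tensor_map R M N2 g ` carrier (tensor_product R M N1) = (\<lambda>w. ?c (formal_map g w)) ` ?F"
    by (simp add: g.N.carrier_tensor_product image_image g.tensor_map_coset)
  have c0: "h.N'.relations #>\<^bsub>h.N'.formal_sums\<^esub> u = h.N'.relations \<longleftrightarrow> u \<in> h.N'.relations" for u
    using h.N'.relations_coset_eq_iff[of u 0] by (simp add: h.N'.relations_coset_0)
  have ker: "kernel (tensor_product R M N2) (tensor_product R M N3) (tensor_map R M N3 h)
      = ?c ` {z \<in> ?G. formal_map h z \<in> h.N'.relations}"
  proof -
    have "tensor_map R M N3 h (?c z) = \<one>\<^bsub>tensor_product R M N3\<^esub> \<longleftrightarrow> formal_map h z \<in> h.N'.relations"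
      for z
      by (simp add: h.tensor_map_coset h.N'.one_tensor_product c0)
    then show ?thesis
      unfolding kernel_def g.N'.carrier_tensor_product by blast
  qed
  have inv: "formal_map h z \<in> h.N'.relations"
    if "?c z = ?c z'" "formal_map h z' \<in> h.N'.relations" for z z'
    using that h.formal_map_relations[of "z - z'"] h.N'.relations_add
    by (force simp: g.N'.relations_coset_eq_iff formal_map_simps)
  have cl: "formal_map g w \<in> ?G" if "w \<in> ?F" for w
    using g.formal_map_closed that .
  show ?thesis
    unfolding exact_at_def im ker g.N'.relations_coset_eq_iff[symmetric]
    by (rule image_eq_image_Collect_iff[where c = ?c and f = "formal_map g"]) (fact cl, fact inv)
qed

end


section \<open>Contraction along functions from M to R\<close>

text \<open>
  A function \<open>a : M \<rightarrow> R\<close> induces a homomorphism from the formal sums to \<open>N\<close> with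
  \<open>(x, y) \<mapsto> a x \<odot> y\<close>, by the universal property of the free abelian group. No linearity of \<open>a\<close>
  is needed for this; linearity only matters for whether the homomorphism vanishes on the
  relations and so descends to \<open>M \<otimes> N\<close>. Outside the formal sums the choice operator leaves the
  value unspecified.
\<close>

definition contraction ::
  "('r, 'a) module \<Rightarrow> ('r, 'b) module \<Rightarrow> ('a \<Rightarrow> 'r) \<Rightarrow> ('a \<times> 'b \<Rightarrow>\<^sub>0 int) \<Rightarrow> 'b" where
  "contraction M N a =
     (SOME \<Phi>. \<Phi> \<in> hom (free_Abelian_group (carrier M \<times> carrier N)) (add_monoid N) \<and>
        (\<forall>x\<in>carrier M. \<forall>y\<in>carrier N. \<Phi> (frag_of (x, y)) = a x \<odot>\<^bsub>N\<^esub> y))"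

text \<open>
  The function \<open>a\<close> behaves linearly at designated places: it is additive at the
  pairs in \<open>A\<close> and homogeneous at the pairs in \<open>B\<close>. A function need not be linear elsewhere.
\<close>

definition linear_on_pairs ::
  "('r, 'm) ring_scheme \<Rightarrow> ('r, 'a) module \<Rightarrow> ('a \<times> 'a) set \<Rightarrow> ('r \<times> 'a) set \<Rightarrow> ('a \<Rightarrow> 'r) \<Rightarrow> bool" where
  "linear_on_pairs R M A B a \<longleftrightarrow>
     a \<in> carrier M \<rightarrow> carrier R \<and>
     (\<forall>(x, x')\<in>A. a (x \<oplus>\<^bsub>M\<^esub> x') = a x \<oplus>\<^bsub>R\<^esub> a x') \<and>
     (\<forall>(r, x)\<in>B. a (r \<odot>\<^bsub>M\<^esub> x) = r \<otimes>\<^bsub>R\<^esub> a x)"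

context tensor_factors
begin

lemma contraction_hom:
  assumes "a \<in> carrier M \<rightarrow> carrier R"
  shows "contraction M N a \<in> hom formal_sums (add_monoid N) \<and>
    (\<forall>x\<in>carrier M. \<forall>y\<in>carrier N. contraction M N a (frag_of (x, y)) = a x \<odot>\<^bsub>N\<^esub> y)"
proof -
  have "(\<lambda>(x, y). a x \<odot>\<^bsub>N\<^esub> y) ` (carrier M \<times> carrier N) \<subseteq> carrier (add_monoid N)"
    using assms by (auto intro: N.smult_closed)
  from comm_group.free_Abelian_group_universal[OF N.a_comm_group this]
  obtain \<Phi> where "\<Phi> \<in> hom formal_sums (add_monoid N)"
    "\<And>p. p \<in> carrier M \<times> carrier N \<Longrightarrow> \<Phi> (frag_of p) = (case p of (x, y) \<Rightarrow> a x \<odot>\<^bsub>N\<^esub> y)"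
    by blast
  then have "\<exists>\<Phi>. \<Phi> \<in> hom formal_sums (add_monoid N) \<and>
    (\<forall>x\<in>carrier M. \<forall>y\<in>carrier N. \<Phi> (frag_of (x, y)) = a x \<odot>\<^bsub>N\<^esub> y)"
    by auto
  then show ?thesis
    unfolding contraction_def by (rule someI_ex)
qed

lemma contraction_frag_of:
  "\<lbrakk>a \<in> carrier M \<rightarrow> carrier R; x \<in> carrier M; y \<in> carrier N\<rbrakk>
    \<Longrightarrow> contraction M N a (frag_of (x, y)) = a x \<odot>\<^bsub>N\<^esub> y"
  using contraction_hom by blast

lemma contraction_group_hom:
  "a \<in> carrier M \<rightarrow> carrier R \<Longrightarrow> group_hom formal_sums (add_monoid N) (contraction M N a)"
  using contraction_hom N.a_group by (simp add: group_hom_def group_hom_axioms_def)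

lemma contraction_closed:
  "\<lbrakk>a \<in> carrier M \<rightarrow> carrier R; z \<in> carrier formal_sums\<rbrakk> \<Longrightarrow> contraction M N a z \<in> carrier N"
  using group_hom.hom_closed[OF contraction_group_hom] by fastforce

lemma contraction_0: "a \<in> carrier M \<rightarrow> carrier R \<Longrightarrow> contraction M N a 0 = \<zero>\<^bsub>N\<^esub>"
  using group_hom.hom_one[OF contraction_group_hom] by fastforce

lemma contraction_add:
  "\<lbrakk>a \<in> carrier M \<rightarrow> carrier R; u \<in> carrier formal_sums; v \<in> carrier formal_sums\<rbrakk>
    \<Longrightarrow> contraction M N a (u + v) = contraction M N a u \<oplus>\<^bsub>N\<^esub> contraction M N a v"
  using group_hom.hom_mult[OF contraction_group_hom] by fastforce

lemma contraction_minus: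
  "\<lbrakk>a \<in> carrier M \<rightarrow> carrier R; u \<in> carrier formal_sums\<rbrakk>
    \<Longrightarrow> contraction M N a (- u) = \<ominus>\<^bsub>N\<^esub> contraction M N a u"
  using group_hom.hom_inv[OF contraction_group_hom, of a u] by (simp add: a_inv_def)

lemma contraction_diff:
  assumes "a \<in> carrier M \<rightarrow> carrier R" "u \<in> carrier formal_sums" "v \<in> carrier formal_sums"
  shows "contraction M N a (u - v) = contraction M N a u \<ominus>\<^bsub>N\<^esub> contraction M N a v"
proof -
  have "- v \<in> carrier formal_sums"
    using assms by simp
  then show ?thesis
    using contraction_add[of a u "- v"] contraction_minus[of a v] assms
    by (simp add: a_minus_def)
qed

text \<open>
  A single relation \<open>u\<close> is a combination of finitely many bilinearity relators, so contracting it
  only uses finitely many instances of the linearity of \<open>a\<close>.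
\<close>

lemma contraction_relations_constraints:
  assumes "u \<in> relations"
  shows "\<exists>A B. finite A \<and> A \<subseteq> carrier M \<times> carrier M \<and> finite B \<and> B \<subseteq> carrier R \<times> carrier M \<and>
    (\<forall>a. linear_on_pairs R M A B a \<longrightarrow> contraction M N a u = \<zero>\<^bsub>N\<^esub>)"
  using assms
proof (induction rule: relations_induct)
  case (relator u)
  then consider
      (left) x x' y where "u = frag_of (x \<oplus>\<^bsub>M\<^esub> x', y) - frag_of (x, y) - frag_of (x', y)"
        "x \<in> carrier M" "x' \<in> carrier M" "y \<in> carrier N"
    | (right) x y y' where "u = frag_of (x, y \<oplus>\<^bsub>N\<^esub> y') - frag_of (x, y) - frag_of (x, y')"
        "x \<in> carrier M" "y \<in> carrier N" "y' \<in> carrier N"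
    | (smult) r x y where "u = frag_of (r \<odot>\<^bsub>M\<^esub> x, y) - frag_of (x, r \<odot>\<^bsub>N\<^esub> y)"
        "r \<in> carrier R" "x \<in> carrier M" "y \<in> carrier N"
    unfolding tensor_relators_def by blast
  then show ?case
  proof cases
    case left
    have "contraction M N a u = \<zero>\<^bsub>N\<^esub>" if "linear_on_pairs R M {(x, x')} {} a" for a
    proof -
      have a: "a \<in> carrier M \<rightarrow> carrier R" "a (x \<oplus>\<^bsub>M\<^esub> x') = a x \<oplus> a x'"
        using that by (auto simp: linear_on_pairs_def)
      have [simp]: "a x \<in> carrier R" "a x' \<in> carrier R"
        using a(1) left by auto
      have u: "u = frag_of (x \<oplus>\<^bsub>M\<^esub> x', y) - (frag_of (x, y) + frag_of (x', y))"
        using left by simp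
      have "frag_of (x, y) + frag_of (x', y) \<in> carrier formal_sums"
        using left keys_add[of "frag_of (x, y)" "frag_of (x', y)"] by auto
      then show ?thesis
        unfolding u using left(2-4) a
        by (simp add: contraction_diff[of a "frag_of (x \<oplus>\<^bsub>M\<^esub> x', y)"] contraction_add
            contraction_frag_of N.smult_l_distr a_minus_def N.r_neg)
    qed
    then show ?thesis
      using left by (intro exI[of _ "{(x, x')}"] exI[of _ "{}"]) auto
  next
    case right
    have "contraction M N a u = \<zero>\<^bsub>N\<^esub>" if "linear_on_pairs R M {} {} a" for a
    proof -
      have a: "a \<in> carrier M \<rightarrow> carrier R"
        using that by (auto simp: linear_on_pairs_def)
      have [simp]: "a x \<in> carrier R"
        using a(1) right by auto
      have u: "u = frag_of (x, y \<oplus>\<^bsub>N\<^esub> y') - (frag_of (x, y) + frag_of (x, y'))"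
        using right by simp
      have "frag_of (x, y) + frag_of (x, y') \<in> carrier formal_sums"
        using right keys_add[of "frag_of (x, y)" "frag_of (x, y')"] by auto
      then show ?thesis
        unfolding u using right(2-4) a
        by (simp add: contraction_diff[of a "frag_of (x, y \<oplus>\<^bsub>N\<^esub> y')"] contraction_add
            contraction_frag_of N.smult_r_distr a_minus_def N.r_neg)
    qed
    then show ?thesis
      by (intro exI[of _ "{}"]) auto
  next
    case smult
    have "contraction M N a u = \<zero>\<^bsub>N\<^esub>" if "linear_on_pairs R M {} {(r, x)} a" for a
    proof -
      have a: "a \<in> carrier M \<rightarrow> carrier R" "a (r \<odot>\<^bsub>M\<^esub> x) = r \<otimes> a x"
        using that by (auto simp: linear_on_pairs_def)
      have [simp]: "a x \<in> carrier R"
        using a(1) smult by auto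
      have "r \<otimes> a x = a x \<otimes> r"
        using smult by (simp add: M.m_comm)
      then show ?thesis
        unfolding smult(1) using smult(2-4) a
        by (simp add: contraction_diff contraction_frag_of N.smult_assoc1 a_minus_def N.r_neg)
    qed
    then show ?thesis
      using smult by (intro exI[of _ "{}"] exI[of _ "{(r, x)}"]) auto
  qed
next
  case zero
  then show ?case
    by (intro exI[of _ "{}"]) (auto simp: linear_on_pairs_def contraction_0)
next
  case (add u v)
  then obtain A B A' B' where
    AB: "finite A" "A \<subseteq> carrier M \<times> carrier M" "finite B" "B \<subseteq> carrier R \<times> carrier M"
      "\<And>a. linear_on_pairs R M A B a \<Longrightarrow> contraction M N a u = \<zero>\<^bsub>N\<^esub>" and
    AB': "finite A'" "A' \<subseteq> carrier M \<times> carrier M" "finite B'" "B' \<subseteq> carrier R \<times> carrier M"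
      "\<And>a. linear_on_pairs R M A' B' a \<Longrightarrow> contraction M N a v = \<zero>\<^bsub>N\<^esub>"
    by blast
  have "contraction M N a (u + v) = \<zero>\<^bsub>N\<^esub>" if "linear_on_pairs R M (A \<union> A') (B \<union> B') a" for a
  proof -
    have "a \<in> carrier M \<rightarrow> carrier R" "linear_on_pairs R M A B a" "linear_on_pairs R M A' B' a"
      using that by (auto simp: linear_on_pairs_def)
    then show ?thesis
      using AB(5) AB'(5) add.hyps relations_keys by (simp add: contraction_add)
  qed
  then show ?case
    using AB(1-4) AB'(1-4) by (intro exI[of _ "A \<union> A'"] exI[of _ "B \<union> B'"]) simp
next
  case (minus u)
  have "contraction M N a (- u) = \<zero>\<^bsub>N\<^esub>"
    if "linear_on_pairs R M A B a" "contraction M N a u = \<zero>\<^bsub>N\<^esub>" for A B a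
    using that minus.hyps relations_keys by (simp add: contraction_minus linear_on_pairs_def)
  with minus.IH show ?case
    by meson
qed

text \<open>
  If each \<open>x\<close> in \<open>S\<close> equals \<open>\<Sum>j. a j x \<odot> j\<close>, then \<open>\<Sum> x \<otimes> y\<close> can be rewritten as
  \<open>\<Sum>j. j \<otimes> (\<Sum> a j x \<odot> y)\<close>; the right-hand factors are the contractions along the \<open>a j\<close>.
\<close>

lemma coordinate_expansion:
  assumes T: "finite T" "T \<subseteq> carrier M" "\<And>j. j \<in> T \<Longrightarrow> a j \<in> carrier M \<rightarrow> carrier R"
    and S: "S \<subseteq> carrier M" "\<And>x. x \<in> S \<Longrightarrow> x = (\<Oplus>\<^bsub>M\<^esub>j\<in>T. a j x \<odot>\<^bsub>M\<^esub> j)"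
    and z: "Poly_Mapping.keys z \<subseteq> S \<times> carrier N"
  shows "z - (\<Sum>j\<in>T. frag_of (j, contraction M N (a j) z)) \<in> relations"
proof -
  let ?e = "\<lambda>z. \<Sum>j\<in>T. frag_of (j, contraction M N (a j) z)"
  have "z \<in> carrier formal_sums \<and> z - ?e z \<in> relations"
    using z
  proof (induction z rule: frag_induction)
    case zero
    have "?e 0 = (\<Sum>j\<in>T. frag_of (j, \<zero>\<^bsub>N\<^esub>))"
      using T by (simp add: contraction_0)
    also have "\<dots> \<in> relations"
      using T by (intro relations_sum relations_zero_right) auto
    finally show ?case
      using relations_minus by simp
  next
    case (one p)
    then obtain x y where p: "p = (x, y)" "x \<in> S" "x \<in> carrier M" "y \<in> carrier N"
      using S by auto
    have aj: "a j x \<in> carrier R" "j \<in> carrier M" if "j \<in> T" for j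
      using T(2) T(3)[OF that] that p by auto
    \<comment> \<open>Pull the sum out of the first factor, then move each scalar across to the second.\<close>
    have "(frag_of (\<Oplus>\<^bsub>M\<^esub>j\<in>T. a j x \<odot>\<^bsub>M\<^esub> j, y) - (\<Sum>j\<in>T. frag_of (a j x \<odot>\<^bsub>M\<^esub> j, y)))
      + (\<Sum>j\<in>T. frag_of (a j x \<odot>\<^bsub>M\<^esub> j, y) - frag_of (j, a j x \<odot>\<^bsub>N\<^esub> y)) \<in> relations"
      using T(1) p aj
      by (intro relations_add relations_sum relations_smult relations_finsum_left) auto
    then have "frag_of (x, y) - (\<Sum>j\<in>T. frag_of (j, a j x \<odot>\<^bsub>N\<^esub> y)) \<in> relations"
      using S(2)[OF p(2)] by (simp add: sum_subtractf)
    moreover have "?e (frag_of (x, y)) = (\<Sum>j\<in>T. frag_of (j, a j x \<odot>\<^bsub>N\<^esub> y))"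
      using T p by (intro sum.cong) (auto simp: contraction_frag_of)
    ultimately show ?case
      using p by simp
  next
    case (diff u v)
    let ?d = "\<lambda>j. frag_of (j, contraction M N (a j) u \<ominus>\<^bsub>N\<^esub> contraction M N (a j) v)
      - (frag_of (j, contraction M N (a j) u) - frag_of (j, contraction M N (a j) v))"
    have "?d j \<in> relations" if "j \<in> T" for j
      using diff T(2) that contraction_closed[OF T(3)[OF that]]
      by (intro relations_diff_right) auto
    then have "(\<Sum>j\<in>T. ?d j) \<in> relations"
      by (rule relations_sum)
    then have "(u - ?e u) - (v - ?e v) - (\<Sum>j\<in>T. ?d j) \<in> relations"
      using diff by (intro relations_diff[OF relations_diff]) auto
    moreover have "?e (u - v) = (\<Sum>j\<in>T. frag_of (j, contraction M N (a j) u \<ominus>\<^bsub>N\<^esub> contraction M N (a j) v))"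
      using diff T by (intro sum.cong) (auto simp: contraction_diff)
    ultimately have "(u - v) - ?e (u - v) \<in> relations"
      by (simp add: sum_subtractf sum.distrib algebra_simps)
    then show ?case
      using diff keys_diff[of u v] by auto
  qed
  then show ?thesis ..
qed

end

text \<open>
  Contraction is natural in \<open>N\<close>.
\<close>

lemma (in tensored_map) contraction_formal_map:
  assumes a: "a \<in> carrier M \<rightarrow> carrier R" and z: "z \<in> carrier N.formal_sums"
  shows "contraction M N' a (formal_map g z) = g (contraction M N a z)"
proof -
  have g: "group_hom (add_monoid N) (add_monoid N') g"
    using linear N.N.a_group N'.N.a_group
    by (simp add: linear_map_def group_hom_def group_hom_axioms_def)
  have g_minus: "g (x \<ominus>\<^bsub>N\<^esub> y) = g x \<ominus>\<^bsub>N'\<^esub> g y" if "x \<in> carrier N" "y \<in> carrier N" for x y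
    using that group_hom.hom_inv[OF g, of y] map_add[of x "\<ominus>\<^bsub>N\<^esub> y"]
    by (simp add: a_minus_def a_inv_def[symmetric])
  have "Poly_Mapping.keys z \<subseteq> carrier M \<times> carrier N"
    using z by simp
  then have "z \<in> carrier N.formal_sums \<and> contraction M N' a (formal_map g z) = g (contraction M N a z)"
  proof (induction z rule: frag_induction)
    case zero
    then show ?case
      using group_hom.hom_one[OF g] a
      by (simp add: formal_map_simps N.contraction_0 N'.contraction_0)
  next
    case (one p)
    then obtain x y where "p = (x, y)" "x \<in> carrier M" "y \<in> carrier N"
      by auto
    then show ?case
      using a funcset_mem[OF a, of x]
      by (simp add: formal_map_simps N.contraction_frag_of N'.contraction_frag_of
          map_closed map_smult)
  next
    case (diff u v)
    then show ?case
      using a formal_map_closed[of u] formal_map_closed[of v] keys_diff[of u v]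
        N.contraction_closed[OF a, of u] N.contraction_closed[OF a, of v]
      by (auto simp: formal_map_simps N.contraction_diff N'.contraction_diff g_minus)
  qed
  then show ?thesis ..
qed


section \<open>Criteria for flatness and faithfulness\<close>

text \<open>
  Finitely many elements of \<open>M\<close>, subject to finitely many additive and scalar relations among
  elements of \<open>M\<close>, can be expressed through coordinates in \<open>R\<close> that satisfy the same relations.
  This is Lazard's condition that every map from a finitely presented module to \<open>M\<close> factors
  through a finite free module: the coordinates \<open>a j x\<close> are the map into the free module on \<open>T\<close>.
\<close>

definition factors_through_free :: "('r, 'm) ring_scheme \<Rightarrow> ('r, 'a) module \<Rightarrow> bool" where
  "factors_through_free R M \<longleftrightarrow>
     (\<forall>S A B. finite S \<and> S \<subseteq> carrier M \<and> finite A \<and> A \<subseteq> carrier M \<times> carrier M \<and>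
        finite B \<and> B \<subseteq> carrier R \<times> carrier M \<longrightarrow>
        (\<exists>T a. finite T \<and> T \<subseteq> carrier M \<and> (\<forall>j\<in>T. linear_on_pairs R M A B (a j)) \<and>
           (\<forall>x\<in>S. x = (\<Oplus>\<^bsub>M\<^esub>j\<in>T. a j x \<odot>\<^bsub>M\<^esub> j))))"

context tensor_sequence
begin

text \<open>
  Flatness. If \<open>(id \<otimes> h) z\<close> vanishes, take coordinates \<open>a j\<close> for the first factors of \<open>z\<close> that
  respect the finitely many relations which witness this. The contractions of \<open>z\<close> along the
  \<open>a j\<close> then lie in the kernel of \<open>h\<close>, hence in the image of \<open>g\<close>, and \<open>z\<close> is recovered from
  them by its coordinate expansion.
\<close>

lemma tensor_exact_if_exact:
  assumes free: "factors_through_free R M"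
    and "exact_at (add_monoid N1) (add_monoid N2) (add_monoid N3) g h"
  shows "exact_at (tensor_product R M N1) (tensor_product R M N2) (tensor_product R M N3)
       (tensor_map R M N2 g) (tensor_map R M N3 h)"
proof -
  have hg: "\<And>x. x \<in> carrier N1 \<Longrightarrow> h (g x) = \<zero>\<^bsub>N3\<^esub>"
    and ker: "\<And>y. y \<in> carrier N2 \<Longrightarrow> h y = \<zero>\<^bsub>N3\<^esub> \<Longrightarrow> \<exists>x\<in>carrier N1. y = g x"
    using assms(2) exact_at_iff by auto
  have "formal_map h (formal_map g w) \<in> h.N'.relations"
    if "Poly_Mapping.keys w \<subseteq> carrier M \<times> carrier N1" for w
    using that
  proof (induction w rule: frag_induction)
    case (one p)
    then show ?case
      by (auto simp: formal_map_simps hg intro: h.N'.relations_zero_right)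
  qed (simp_all add: formal_map_simps h.N'.relations_0 h.N'.relations_diff)
  moreover have "\<exists>w\<in>carrier g.N.formal_sums. z - formal_map g w \<in> g.N'.relations"
    if z: "z \<in> carrier g.N'.formal_sums" and hz: "formal_map h z \<in> h.N'.relations" for z
  proof -
    obtain A B where AB: "finite A" "A \<subseteq> carrier M \<times> carrier M" "finite B" "B \<subseteq> carrier R \<times> carrier M"
      "\<And>a. linear_on_pairs R M A B a \<Longrightarrow> contraction M N3 a (formal_map h z) = \<zero>\<^bsub>N3\<^esub>"
      using h.N'.contraction_relations_constraints[OF hz] by blast
    define S where "S = fst ` Poly_Mapping.keys z"
    have S: "finite S" "S \<subseteq> carrier M" and zS: "Poly_Mapping.keys z \<subseteq> S \<times> carrier N2"
      using z by (force simp: S_def)+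
    have "\<exists>T a. finite T \<and> T \<subseteq> carrier M \<and> (\<forall>j\<in>T. linear_on_pairs R M A B (a j)) \<and>
        (\<forall>x\<in>S. x = (\<Oplus>\<^bsub>M\<^esub>j\<in>T. a j x \<odot>\<^bsub>M\<^esub> j))"
      using free S AB(1-4) by (simp add: factors_through_free_def)
    then obtain T a where T: "finite T" "T \<subseteq> carrier M"
      and a: "\<And>j. j \<in> T \<Longrightarrow> linear_on_pairs R M A B (a j)"
      and x: "\<And>x. x \<in> S \<Longrightarrow> x = (\<Oplus>\<^bsub>M\<^esub>j\<in>T. a j x \<odot>\<^bsub>M\<^esub> j)"
      by blast
    have a': "a j \<in> carrier M \<rightarrow> carrier R" if "j \<in> T" for j
      using a[OF that] by (simp add: linear_on_pairs_def)
    have "\<exists>x\<in>carrier N1. contraction M N2 (a j) z = g x" if "j \<in> T" for j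
    proof (rule ker)
      show "contraction M N2 (a j) z \<in> carrier N2"
        using g.N'.contraction_closed[OF a'[OF that] z] .
      show "h (contraction M N2 (a j) z) = \<zero>\<^bsub>N3\<^esub>"
        using AB(5)[OF a[OF that]] h.contraction_formal_map[OF a'[OF that] z] by simp
    qed
    then obtain w where w: "\<And>j. j \<in> T \<Longrightarrow> w j \<in> carrier N1 \<and> contraction M N2 (a j) z = g (w j)"
      by metis
    let ?w = "\<Sum>j\<in>T. frag_of (j, w j)"
    have "?w \<in> carrier g.N.formal_sums"
      using T w by (intro sum_closed_free_Abelian_group) auto
    moreover have "formal_map g ?w = (\<Sum>j\<in>T. frag_of (j, contraction M N2 (a j) z))"
      using w by (simp add: formal_map_sum formal_map_simps)
    ultimately show ?thesis
      using g.N'.coordinate_expansion[OF T a' S(2) x zS] by metis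
  qed
  ultimately show ?thesis
    unfolding exact_at_tensor_iff by simp
qed

text \<open>
  Faithfulness. The maps \<open>y \<mapsto> u \<otimes> y\<close> and contraction along \<open>a\<close> make \<open>N\<close> a retract of \<open>M \<otimes> N\<close>,
  naturally in \<open>N\<close>, and a retract of an exact sequence is exact.
\<close>

lemma exact_if_tensor_exact:
  assumes a: "a \<in> carrier M \<rightarrow> carrier R"
      "\<And>x x'. x \<in> carrier M \<Longrightarrow> x' \<in> carrier M \<Longrightarrow> a (x \<oplus>\<^bsub>M\<^esub> x') = a x \<oplus> a x'"
      "\<And>r x. r \<in> carrier R \<Longrightarrow> x \<in> carrier M \<Longrightarrow> a (r \<odot>\<^bsub>M\<^esub> x) = r \<otimes> a x"
    and u: "u \<in> carrier M" "a u = \<one>"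
    and ex: "exact_at (tensor_product R M N1) (tensor_product R M N2) (tensor_product R M N3)
       (tensor_map R M N2 g) (tensor_map R M N3 h)"
  shows "exact_at (add_monoid N1) (add_monoid N2) (add_monoid N3) g h"
proof -
  have lin: "linear_on_pairs R M A B a" if "A \<subseteq> carrier M \<times> carrier M" "B \<subseteq> carrier R \<times> carrier M" for A B
    using that a by (auto simp: linear_on_pairs_def)
  have kill2: "contraction M N2 a v = \<zero>\<^bsub>N2\<^esub>" if "v \<in> g.N'.relations" for v
    using g.N'.contraction_relations_constraints[OF that] lin by blast
  have kill3: "contraction M N3 a v = \<zero>\<^bsub>N3\<^esub>" if "v \<in> h.N'.relations" for v
    using h.N'.contraction_relations_constraints[OF that] lin by blast
  have "h (g x) = \<zero>\<^bsub>N3\<^esub>" if x: "x \<in> carrier N1" for x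
  proof -
    have "frag_of (u, h (g x)) \<in> h.N'.relations"
      using ex x u unfolding exact_at_tensor_iff
      by (force simp: formal_map_simps dest: bspec[of _ _ "frag_of (u, x)"])
    from kill3[OF this] show ?thesis
      using a(1) u x by (simp add: h.N'.contraction_frag_of g.map_closed h.map_closed)
  qed
  moreover have "\<exists>x\<in>carrier N1. y = g x" if y: "y \<in> carrier N2" "h y = \<zero>\<^bsub>N3\<^esub>" for y
  proof -
    have "formal_map h (frag_of (u, y)) \<in> h.N'.relations"
      using y u h.N'.relations_zero_right by (simp add: formal_map_simps)
    moreover have "frag_of (u, y) \<in> carrier g.N'.formal_sums"
      using y u by simp
    ultimately obtain w where w: "w \<in> carrier g.N.formal_sums"
      "frag_of (u, y) - formal_map g w \<in> g.N'.relations"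
      using ex unfolding exact_at_tensor_iff by blast
    have gw: "formal_map g w \<in> carrier g.N'.formal_sums"
      using g.formal_map_closed w(1) .
    have c: "contraction M N1 a w \<in> carrier N1"
      using g.N.contraction_closed a(1) w(1) .
    have "y \<ominus>\<^bsub>N2\<^esub> g (contraction M N1 a w) = \<zero>\<^bsub>N2\<^esub>"
      using kill2[OF w(2)] a(1) y u w(1) gw
      by (simp add: g.N'.contraction_diff g.N'.contraction_frag_of g.contraction_formal_map)
    moreover have "y = (y \<ominus>\<^bsub>N2\<^esub> g (contraction M N1 a w)) \<oplus>\<^bsub>N2\<^esub> g (contraction M N1 a w)"
      using y c g.map_closed by (simp add: a_minus_def g.N'.N.a_assoc g.N'.N.l_neg)
    ultimately have "y = g (contraction M N1 a w)"
      using c g.map_closed by simp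
    with c show ?thesis
      by blast
  qed
  ultimately show ?thesis
    unfolding exact_at_iff by blast
qed

end

text \<open>
  The linear map \<open>a : M \<rightarrow> R\<close> with \<open>a u = 1\<close> exhibits \<open>R\<close> as a direct summand of \<open>M\<close>.
\<close>

theorem faithfully_flat_if_retract:
  assumes "module R M" "factors_through_free R M"
    and "a \<in> carrier M \<rightarrow> carrier R"
      "\<And>x x'. x \<in> carrier M \<Longrightarrow> x' \<in> carrier M \<Longrightarrow> a (x \<oplus>\<^bsub>M\<^esub> x') = a x \<oplus>\<^bsub>R\<^esub> a x'"
      "\<And>r x. r \<in> carrier R \<Longrightarrow> x \<in> carrier M \<Longrightarrow> a (r \<odot>\<^bsub>M\<^esub> x) = r \<otimes>\<^bsub>R\<^esub> a x"
    and "u \<in> carrier M" "a u = \<one>\<^bsub>R\<^esub>"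
  shows "faithfully_flat TYPE('n1 \<times> 'n2 \<times> 'n3) R M"
  unfolding faithfully_flat_def
proof (intro conjI allI impI)
  fix N1 :: "('a, 'n1) module" and N2 :: "('a, 'n2) module" and N3 :: "('a, 'n3) module" and g h
  assume "module R N1 \<and> module R N2 \<and> module R N3 \<and> linear_map R N1 N2 g \<and> linear_map R N2 N3 h"
  with assms(1) interpret tensor_sequence R M N1 N2 N3 g h
    by (simp add: tensor_sequence_def tensored_map_def tensored_map_axioms_def
        tensor_factors_def)
  show "exact_at (add_monoid N1) (add_monoid N2) (add_monoid N3) g h \<longleftrightarrow>
      exact_at (tensor_product R M N1) (tensor_product R M N2) (tensor_product R M N3)
       (tensor_map R M N2 g) (tensor_map R M N3 h)"
    using tensor_exact_if_exact[OF assms(2)] exact_if_tensor_exact[OF assms(3-7)] by blast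
qed (fact assms(1))


section \<open>Linear relations over Pruefer domains\<close>

lemma ring_on_simps [simp]:
  "carrier (ring_on D) = D" "x \<oplus>\<^bsub>ring_on D\<^esub> y = x + y" "x \<otimes>\<^bsub>ring_on D\<^esub> y = x * y"
  "\<zero>\<^bsub>ring_on D\<^esub> = 0" "\<one>\<^bsub>ring_on D\<^esub> = 1"
  by (simp_all add: ring_on_def ring_of_type_algebra_def)

lemma prufer_domain_cring:
  assumes "prufer_domain D"
  shows "cring (ring_on D)"
proof -
  interpret K: field "ring_of_type_algebra :: 'a ring"
    by (rule field_from_type_algebra)
  have "subdomain D ring_of_type_algebra"
    using assms by (simp add: prufer_domain_def)
  then have "domain (ring_on D)"
    unfolding ring_on_def by (rule K.subdomain_is_domain)
  then show ?thesis
    by (simp add: domain_def)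
qed

locale prufer =
  fixes D :: "'k::field set"
  assumes prufer: "prufer_domain D"
begin

sublocale D: cring "ring_on D"
  using prufer by (rule prufer_domain_cring)

lemma zero_mem: "0 \<in> D" and one_mem: "1 \<in> D"
  using D.zero_closed D.one_closed by simp_all

lemma add_mem: "x \<in> D \<Longrightarrow> y \<in> D \<Longrightarrow> x + y \<in> D"
  and mult_mem: "x \<in> D \<Longrightarrow> y \<in> D \<Longrightarrow> x * y \<in> D"
  using D.add.m_closed D.m_closed by simp_all

lemma uminus_mem: "x \<in> D \<Longrightarrow> - x \<in> D"
  using D.a_inv_closed[of x] D.r_neg[of x] by (simp add: add_eq_0_iff)

lemma diff_mem: "x \<in> D \<Longrightarrow> y \<in> D \<Longrightarrow> x - y \<in> D"
  using add_mem[of x "- y"] uminus_mem by simp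

lemma sum_mem: "(\<And>i. i \<in> I \<Longrightarrow> f i \<in> D) \<Longrightarrow> sum f I \<in> D"
  by (induction I rule: infinite_finite_induct) (auto intro: zero_mem add_mem)

lemma a_inv_eq: "x \<in> D \<Longrightarrow> \<ominus>\<^bsub>ring_on D\<^esub> x = - x"
  using D.r_neg[of x] by (simp add: add_eq_0_iff)

lemma genideal_combination:
  assumes "finite S" "c \<in> S \<rightarrow> D" "x \<in> genideal (ring_on D) (c ` S)"
  obtains d where "d \<in> S \<rightarrow> D" "x = (\<Sum>i\<in>S. c i * d i)"
proof -
  let ?L = "{\<Sum>i\<in>S. c i * d i | d. d \<in> S \<rightarrow> D}"
  have L: "ideal ?L (ring_on D)"
  proof (rule idealI)
    show "subgroup ?L (add_monoid (ring_on D))"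
    proof (rule group.subgroupI[OF D.a_group])
      show "?L \<subseteq> carrier (add_monoid (ring_on D))"
        using assms(2) by (auto intro!: sum_mem mult_mem)
      have "(\<Sum>i\<in>S. c i * (\<lambda>_. 0) i) \<in> ?L"
        using zero_mem by (intro CollectI exI[of _ "\<lambda>_. 0"]) auto
      then show "?L \<noteq> {}"
        by (metis empty_iff)
      show "inv\<^bsub>add_monoid (ring_on D)\<^esub> x \<in> ?L" if x: "x \<in> ?L" for x
      proof -
        obtain d where d: "d \<in> S \<rightarrow> D" "x = (\<Sum>i\<in>S. c i * d i)"
          using x by blast
        have "x \<in> D"
          using d assms(2) by (auto intro!: sum_mem mult_mem)
        then have "inv\<^bsub>add_monoid (ring_on D)\<^esub> x = - x"
          using a_inv_eq by (simp add: a_inv_def)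
        also have "\<dots> = (\<Sum>i\<in>S. c i * - d i)"
          by (simp add: d sum_negf)
        finally show ?thesis
          using d uminus_mem by (intro CollectI exI[of _ "\<lambda>i. - d i"]) auto
      qed
      show "x \<otimes>\<^bsub>add_monoid (ring_on D)\<^esub> y \<in> ?L" if xy: "x \<in> ?L" "y \<in> ?L" for x y
      proof -
        obtain d d' where "d \<in> S \<rightarrow> D" "x = (\<Sum>i\<in>S. c i * d i)"
          "d' \<in> S \<rightarrow> D" "y = (\<Sum>i\<in>S. c i * d' i)"
          using xy by blast
        then show ?thesis
          using add_mem by (intro CollectI exI[of _ "\<lambda>i. d i + d' i"])
            (auto simp: sum.distrib distrib_left)
      qed
    qed
    show mult: "x \<otimes>\<^bsub>ring_on D\<^esub> a \<in> ?L" if xa: "a \<in> ?L" "x \<in> carrier (ring_on D)" for a x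
    proof -
      obtain d where "d \<in> S \<rightarrow> D" "a = (\<Sum>i\<in>S. c i * d i)"
        using xa by blast
      then show ?thesis
        using mult_mem xa(2) by (intro CollectI exI[of _ "\<lambda>i. x * d i"])
          (auto simp: sum_distrib_left mult_ac)
    qed
    show "a \<otimes>\<^bsub>ring_on D\<^esub> x \<in> ?L" if "a \<in> ?L" "x \<in> carrier (ring_on D)" for a x
      using mult[OF that] by (simp add: mult.commute)
  qed (rule D.ring_axioms)
  have "c i \<in> ?L" if "i \<in> S" for i
    using that assms(1) zero_mem one_mem
    by (intro CollectI exI[of _ "\<lambda>j. of_bool (j = i)"]) (auto simp: of_bool_def if_distrib cong: if_cong)
  then have "genideal (ring_on D) (c ` S) \<subseteq> ?L"
    by (intro D.genideal_minimal[OF L]) blast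
  then show ?thesis
    using assms(3) that by blast
qed

text \<open>
  Invertibility of the ideal generated by the \<open>c i\<close>, read off on generators: the \<open>s i\<close> lie in
  the inverse ideal.
\<close>

lemma inverse_coordinates:
  assumes S: "finite S" "c \<in> S \<rightarrow> D" and k: "k \<in> S" "c k \<noteq> 0"
  obtains s where "(\<Sum>i\<in>S. c i * s i) = 1" "\<And>i j. i \<in> S \<Longrightarrow> j \<in> S \<Longrightarrow> s i * c j \<in> D"
proof -
  let ?I = "genideal (ring_on D) (c ` S)"
  have cI: "c i \<in> ?I" if "i \<in> S" for i
    using D.genideal_self[of "c ` S"] S that by auto
  have "?I \<noteq> {0}"
    using cI[OF k(1)] k(2) by auto
  then have "invertible_ideal D ?I"
    using prufer S unfolding prufer_domain_def by (metis finite_imageI funcset_image)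
  then obtain J where J: "fractional_ideal D J" "ideal_prod ring_of_type_algebra ?I J = D"
    by (auto simp: invertible_ideal_def)
  interpret J: submodule J "ring_on D" field_module
    using J(1) by (simp add: fractional_ideal_def)
  have J_add: "x + y \<in> J" if "x \<in> J" "y \<in> J" for x y
    using J.m_closed[OF that] by (simp add: field_module_def)
  have J_smult: "d * x \<in> J" if "d \<in> D" "x \<in> J" for d x
    using J.smult_closed[of d x] that by (simp add: field_module_def)
  have "\<exists>s. s \<in> S \<rightarrow> J \<and> x = (\<Sum>i\<in>S. c i * s i)"
    if "x \<in> ideal_prod ring_of_type_algebra ?I J" for x
    using that
  proof (induction rule: ideal_prod.induct)
    case (prod i j)
    then obtain d where "d \<in> S \<rightarrow> D" "i = (\<Sum>i\<in>S. c i * d i)"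
      using genideal_combination[OF S] by blast
    moreover from this have "i * j = (\<Sum>i\<in>S. c i * (d i * j))"
      by (simp add: sum_distrib_right mult.assoc)
    moreover have "(\<lambda>i. d i * j) \<in> S \<rightarrow> J"
      using \<open>d \<in> S \<rightarrow> D\<close> prod J_smult by blast
    ultimately show ?case
      unfolding ring_of_type_algebra_def by auto
  next
    case (sum x y)
    then obtain s s' where "s \<in> S \<rightarrow> J" "x = (\<Sum>i\<in>S. c i * s i)"
      "s' \<in> S \<rightarrow> J" "y = (\<Sum>i\<in>S. c i * s' i)"
      by blast
    then show ?case
      using J_add by (intro exI[of _ "\<lambda>i. s i + s' i"])
        (auto simp: ring_of_type_algebra_def sum.distrib distrib_left)
  qed
  then obtain s where s: "s \<in> S \<rightarrow> J" "1 = (\<Sum>i\<in>S. c i * s i)"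
    using J(2) one_mem by blast
  have "s i * c j \<in> D" if "i \<in> S" "j \<in> S" for i j
    using ideal_prod.prod[OF cI[OF that(2)], of "s i" J ring_of_type_algebra] s that J(2)
    by (auto simp: ring_of_type_algebra_def mult.commute)
  with s that show ?thesis
    by metis
qed

end

text \<open>
  The ambient space of a torsion-free \<open>D\<close>-module. A vector space over the field in which \<open>D\<close>
  lives allows scalars such as the \<open>s i\<close> above, which need not belong to \<open>D\<close>, to act on vectors.
\<close>

locale prufer_vector_space = prufer D + vector_space scale
  for D :: "'k::field set" and scale :: "'k \<Rightarrow> 'v::ab_group_add \<Rightarrow> 'v" (infixr \<open>*v\<close> 75)
begin

text \<open>
  A linear relation among the elements of \<open>S\<close> is made trivial by a matrix \<open>A\<close> over \<open>D\<close> that fixes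
  the vector of elements of \<open>S\<close> and on which the row of coefficients \<open>c\<close> acts as zero.
\<close>

lemma kill_relation:
  assumes S: "finite S" "c \<in> S \<rightarrow> D" and rel: "(\<Sum>x\<in>S. c x *v x) = 0"
  obtains A where "\<And>x y. x \<in> S \<Longrightarrow> y \<in> S \<Longrightarrow> A x y \<in> D"
    "\<And>x. x \<in> S \<Longrightarrow> (\<Sum>y\<in>S. A x y *v y) = x"
    "\<And>y. y \<in> S \<Longrightarrow> (\<Sum>x\<in>S. c x * A x y) = 0"
proof (cases "\<exists>k\<in>S. c k \<noteq> 0")
  case False
  have "(\<Sum>y\<in>S. of_bool (x = y) *v y) = x" if "x \<in> S" for x
  proof -
    have "(\<Sum>y\<in>S. of_bool (x = y) *v y) = (\<Sum>y\<in>S. if x = y then y else 0)"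
      by (rule sum.cong) auto
    then show ?thesis
      using that S by simp
  qed
  then show ?thesis
    using that[of "\<lambda>x y. of_bool (x = y)"] False zero_mem one_mem by (auto simp: of_bool_def)
next
  case True
  then obtain s where s: "(\<Sum>x\<in>S. c x * s x) = 1" "\<And>x y. x \<in> S \<Longrightarrow> y \<in> S \<Longrightarrow> s x * c y \<in> D"
    using inverse_coordinates[OF S] by metis
  \<comment> \<open>Subtract from the identity the rank-one matrix of \<open>s\<close> and \<open>c\<close>: as \<open>c \<cdot> s = 1\<close>, it is a projection.\<close>
  let ?A = "\<lambda>x y. of_bool (x = y) - s x * c y"
  have "(\<Sum>y\<in>S. ?A x y *v y) = x" if "x \<in> S" for x
  proof -
    have "(\<Sum>y\<in>S. ?A x y *v y) = (\<Sum>y\<in>S. if x = y then y else 0) - (\<Sum>y\<in>S. s x *v c y *v y)"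
      unfolding sum_subtractf[symmetric]
      by (rule sum.cong) (auto simp: scale_left_diff_distrib)
    also have "\<dots> = x - s x *v (\<Sum>y\<in>S. c y *v y)"
      using that S by (simp add: scale_sum_right)
    finally show ?thesis
      using rel by simp
  qed
  moreover have "(\<Sum>x\<in>S. c x * ?A x y) = 0" if "y \<in> S" for y
  proof -
    have "(\<Sum>x\<in>S. c x * ?A x y) = (\<Sum>x\<in>S. if x = y then c x else 0) - (\<Sum>x\<in>S. (c x * s x) * c y)"
      unfolding sum_subtractf[symmetric]
      by (rule sum.cong) (auto simp: algebra_simps)
    also have "\<dots> = c y - (\<Sum>x\<in>S. c x * s x) * c y"
      using that S by (simp add: sum_distrib_right)
    finally show ?thesis
      using s by simp
  qed
  moreover have "?A x y \<in> D" if "x \<in> S" "y \<in> S" for x y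
    using s(2)[OF that] zero_mem one_mem by (intro diff_mem) auto
  ultimately show ?thesis
    by (intro that[of ?A])
qed

text \<open>
  The same for finitely many relations. If \<open>A\<close> kills the earlier relations, then the row \<open>c A\<close> is
  again a relation, because \<open>A\<close> fixes the elements of \<open>S\<close>; a matrix \<open>B\<close> that kills it turns \<open>A\<close>
  into the product \<open>A B\<close>, which kills all of them.
\<close>

lemma kill_relations:
  assumes "finite C" "finite S"
    and "\<And>c. c \<in> C \<Longrightarrow> c \<in> S \<rightarrow> D" "\<And>c. c \<in> C \<Longrightarrow> (\<Sum>x\<in>S. c x *v x) = 0"
  shows "\<exists>A. (\<forall>x\<in>S. \<forall>y\<in>S. A x y \<in> D) \<and> (\<forall>x\<in>S. (\<Sum>y\<in>S. A x y *v y) = x) \<and>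
    (\<forall>c\<in>C. \<forall>y\<in>S. (\<Sum>x\<in>S. c x * A x y) = 0)"
  using assms
proof (induction C rule: finite_induct)
  case empty
  obtain A where "\<And>x y. x \<in> S \<Longrightarrow> y \<in> S \<Longrightarrow> A x y \<in> D" "\<And>x. x \<in> S \<Longrightarrow> (\<Sum>y\<in>S. A x y *v y) = x"
  proof (rule kill_relation[of S "\<lambda>_. 0"])
    show "(\<lambda>_. 0) \<in> S \<rightarrow> D" "(\<Sum>x\<in>S. 0 *v x) = 0"
      using zero_mem by auto
  qed (use empty in blast)+
  then show ?case
    by blast
next
  case (insert c C)
  have "\<exists>A. (\<forall>x\<in>S. \<forall>y\<in>S. A x y \<in> D) \<and> (\<forall>x\<in>S. (\<Sum>y\<in>S. A x y *v y) = x) \<and>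
    (\<forall>c\<in>C. \<forall>y\<in>S. (\<Sum>x\<in>S. c x * A x y) = 0)"
    using insert.prems by (intro insert.IH) auto
  then obtain A where A: "\<And>x y. x \<in> S \<Longrightarrow> y \<in> S \<Longrightarrow> A x y \<in> D"
    "\<And>x. x \<in> S \<Longrightarrow> (\<Sum>y\<in>S. A x y *v y) = x"
    "\<And>b y. b \<in> C \<Longrightarrow> y \<in> S \<Longrightarrow> (\<Sum>x\<in>S. b x * A x y) = 0"
    by blast
  define c' where "c' y = (\<Sum>x\<in>S. c x * A x y)" for y
  have c: "c \<in> S \<rightarrow> D" "(\<Sum>x\<in>S. c x *v x) = 0"
    using insert.prems by auto
  have c'D: "c' \<in> S \<rightarrow> D"
    using c(1) A(1) unfolding c'_def by (auto intro!: sum_mem mult_mem)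
  have "(\<Sum>y\<in>S. c' y *v y) = (\<Sum>y\<in>S. \<Sum>x\<in>S. c x *v A x y *v y)"
    by (simp add: c'_def scale_sum_left)
  also have "\<dots> = (\<Sum>x\<in>S. c x *v (\<Sum>y\<in>S. A x y *v y))"
    by (subst sum.swap) (simp add: scale_sum_right)
  also have "\<dots> = (\<Sum>x\<in>S. c x *v x)"
    using A(2) by (intro sum.cong) auto
  finally have c'0: "(\<Sum>y\<in>S. c' y *v y) = 0"
    using c(2) by simp
  obtain B where B: "\<And>x y. x \<in> S \<Longrightarrow> y \<in> S \<Longrightarrow> B x y \<in> D" "\<And>x. x \<in> S \<Longrightarrow> (\<Sum>y\<in>S. B x y *v y) = x"
    "\<And>y. y \<in> S \<Longrightarrow> (\<Sum>x\<in>S. c' x * B x y) = 0"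
    using kill_relation[OF \<open>finite S\<close> c'D c'0] by blast
  let ?AB = "\<lambda>x y. \<Sum>z\<in>S. A x z * B z y"
  have "(\<Sum>y\<in>S. ?AB x y *v y) = x" if "x \<in> S" for x
  proof -
    have "(\<Sum>y\<in>S. ?AB x y *v y) = (\<Sum>y\<in>S. \<Sum>z\<in>S. A x z *v B z y *v y)"
      by (simp add: scale_sum_left)
    also have "\<dots> = (\<Sum>z\<in>S. A x z *v (\<Sum>y\<in>S. B z y *v y))"
      by (subst sum.swap) (simp add: scale_sum_right)
    also have "\<dots> = (\<Sum>z\<in>S. A x z *v z)"
      using B(2) by (intro sum.cong) auto
    finally show ?thesis
      using A(2)[OF that] by simp
  qed
  moreover have assoc: "(\<Sum>x\<in>S. b x * ?AB x y) = (\<Sum>z\<in>S. (\<Sum>x\<in>S. b x * A x z) * B z y)" for b y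
  proof -
    have "(\<Sum>x\<in>S. b x * ?AB x y) = (\<Sum>x\<in>S. \<Sum>z\<in>S. b x * A x z * B z y)"
      by (simp add: sum_distrib_left mult.assoc)
    also have "\<dots> = (\<Sum>z\<in>S. \<Sum>x\<in>S. b x * A x z * B z y)"
      by (rule sum.swap)
    finally show ?thesis
      by (simp add: sum_distrib_right)
  qed
  moreover have "(\<Sum>x\<in>S. b x * ?AB x y) = 0" if "b \<in> insert c C" "y \<in> S" for b y
  proof (cases "b = c")
    case True
    then show ?thesis
      using B(3)[OF that(2)] unfolding assoc by (simp add: c'_def)
  next
    case False
    then show ?thesis
      using A(3) that unfolding assoc by simp
  qed
  moreover have "?AB x y \<in> D" if "x \<in> S" "y \<in> S" for x y
    using A(1) B(1) that by (intro sum_mem mult_mem)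
  ultimately show ?case
    by (intro exI[of _ ?AB]) blast
qed

text \<open>
  The module \<open>M\<close> is a \<open>D\<close>-submodule of the vector space, presented as a record. The
  coordinates are the columns of a matrix that kills all the prescribed relations at once, over
  the finite set of all vectors that occur in them.
\<close>

lemma factors_through_free:
  assumes "module (ring_on D) M"
    and add: "\<And>x y. x \<oplus>\<^bsub>M\<^esub> y = x + y" and zero: "\<zero>\<^bsub>M\<^esub> = 0"
    and smult: "\<And>d x. d \<odot>\<^bsub>M\<^esub> x = d *v x"
  shows "factors_through_free (ring_on D) M"
  unfolding factors_through_free_def
proof (intro allI impI, elim conjE)
  interpret M: module "ring_on D" M
    by fact
  fix S0 :: "'v set" and A :: "('v \<times> 'v) set" and B :: "('k \<times> 'v) set"
  assume S0: "finite S0" "S0 \<subseteq> carrier M"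
    and A: "finite A" "A \<subseteq> carrier M \<times> carrier M"
    and B: "finite B" "B \<subseteq> carrier (ring_on D) \<times> carrier M"
  define S where "S = S0 \<union> fst ` A \<union> snd ` A \<union> (\<lambda>(x, x'). x + x') ` A
    \<union> snd ` B \<union> (\<lambda>(r, x). r *v x) ` B"
  have "x + x' \<in> carrier M" if "(x, x') \<in> A" for x x'
    using that A M.a_closed[of x x'] by (auto simp: add)
  moreover have "r *v x \<in> carrier M" if "(r, x) \<in> B" for r x
    using that B M.smult_closed[of r x] by (auto simp: smult)
  ultimately have S: "finite S" "S \<subseteq> carrier M"
    using S0 A B unfolding S_def by auto
  have SA: "x \<in> S" "x' \<in> S" "x + x' \<in> S" if "(x, x') \<in> A" for x x'
    using imageI[OF that, of fst] imageI[OF that, of snd] imageI[OF that, of "\<lambda>(x, x'). x + x'"]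
    by (simp_all add: S_def)
  have SB: "x \<in> S" "r *v x \<in> S" "r \<in> D" if "(r, x) \<in> B" for r x
    using subsetD[OF B(2) that] imageI[OF that, of snd] imageI[OF that, of "\<lambda>(r, x). r *v x"]
    by (simp_all add: S_def)
  \<comment> \<open>The coefficient rows of the relations \<open>(x + x') - x - x' = 0\<close> and \<open>r x - r \<cdot> x = 0\<close>.
      As differences of indicators they remain correct if some of these vectors coincide.\<close>
  define cA :: "'v \<times> 'v \<Rightarrow> 'v \<Rightarrow> 'k" where
    "cA = (\<lambda>(x, x') v. of_bool (v = x + x') - of_bool (v = x) - of_bool (v = x'))"
  define cB :: "'k \<times> 'v \<Rightarrow> 'v \<Rightarrow> 'k" where
    "cB = (\<lambda>(r, x) v. of_bool (v = r *v x) - r * of_bool (v = x))"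
  have bool_mem: "of_bool P \<in> D" for P
    using zero_mem one_mem by simp
  have delta_scale: "(\<Sum>v\<in>S. of_bool (v = x) *v v) = x" if "x \<in> S" for x
  proof -
    have "(\<Sum>v\<in>S. of_bool (v = x) *v v) = (\<Sum>v\<in>S. if v = x then v else 0)"
      by (rule sum.cong) auto
    then show ?thesis
      using that S by simp
  qed
  have delta_mult: "(\<Sum>v\<in>S. of_bool (v = x) * f v) = f x" if "x \<in> S" for x and f :: "'v \<Rightarrow> 'k"
  proof -
    have "(\<Sum>v\<in>S. of_bool (v = x) * f v) = (\<Sum>v\<in>S. if v = x then f v else 0)"
      by (rule sum.cong) auto
    then show ?thesis
      using that S by simp
  qed
  have "\<exists>a. (\<forall>x\<in>S. \<forall>y\<in>S. a x y \<in> D) \<and> (\<forall>x\<in>S. (\<Sum>y\<in>S. a x y *v y) = x) \<and>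
    (\<forall>c\<in>cA ` A \<union> cB ` B. \<forall>y\<in>S. (\<Sum>x\<in>S. c x * a x y) = 0)"
  proof (rule kill_relations)
    show "c \<in> S \<rightarrow> D" if "c \<in> cA ` A \<union> cB ` B" for c
      using that SB(3) by (auto simp: cA_def cB_def intro!: diff_mem mult_mem bool_mem)
    show "(\<Sum>x\<in>S. c x *v x) = 0" if "c \<in> cA ` A \<union> cB ` B" for c
      using that
    proof
      assume "c \<in> cA ` A"
      then show ?thesis
        using SA by (auto simp: cA_def scale_left_diff_distrib sum_subtractf delta_scale)
    next
      assume "c \<in> cB ` B"
      then show ?thesis
        using SB(1,2) by (auto simp: cB_def scale_left_diff_distrib sum_subtractf delta_scale
            scale_scale[symmetric] scale_sum_right[symmetric] simp del: scale_scale)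
    qed
  qed (use A(1) B(1) S(1) in simp_all)
  then obtain a where "\<forall>x\<in>S. \<forall>y\<in>S. a x y \<in> D" "\<forall>x\<in>S. (\<Sum>y\<in>S. a x y *v y) = x"
    "\<forall>c\<in>cA ` A \<union> cB ` B. \<forall>y\<in>S. (\<Sum>x\<in>S. c x * a x y) = 0"
    by (elim exE conjE)
  then have a: "\<And>x y. x \<in> S \<Longrightarrow> y \<in> S \<Longrightarrow> a x y \<in> D"
    "\<And>x. x \<in> S \<Longrightarrow> (\<Sum>y\<in>S. a x y *v y) = x"
    "\<And>c y. c \<in> cA ` A \<union> cB ` B \<Longrightarrow> y \<in> S \<Longrightarrow> (\<Sum>x\<in>S. c x * a x y) = 0"
    by simp_all
  \<comment> \<open>Columns of the matrix, extended by zero outside \<open>S\<close>, are the coordinate functions.\<close>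
  define a' where "a' y x = (if x \<in> S then a x y else 0)" for y x
  have "linear_on_pairs (ring_on D) M A B (a' y)" if y: "y \<in> S" for y
    unfolding linear_on_pairs_def
  proof (intro conjI)
    show "a' y \<in> carrier M \<rightarrow> carrier (ring_on D)"
      using a(1) y zero_mem by (auto simp: a'_def)
    have "a' y (x + x') = a' y x + a' y x'" if "(x, x') \<in> A" for x x'
    proof -
      have "(\<Sum>v\<in>S. cA (x, x') v * a v y) = 0"
        using a(3) y that by blast
      then have "a (x + x') y - a x y - a x' y = 0"
        using SA[OF that] by (simp add: cA_def left_diff_distrib sum_subtractf delta_mult)
      then show ?thesis
        using SA[OF that] by (simp add: a'_def algebra_simps)
    qed
    then show "\<forall>(x, x')\<in>A. a' y (x \<oplus>\<^bsub>M\<^esub> x') = a' y x \<oplus>\<^bsub>ring_on D\<^esub> a' y x'"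
      by (auto simp: add)
    have "a' y (r *v x) = r * a' y x" if "(r, x) \<in> B" for r x
    proof -
      have "(\<Sum>v\<in>S. cB (r, x) v * a v y) = 0"
        using a(3) y that by blast
      then have "a (r *v x) y - r * a x y = 0"
        using SB[OF that] by (simp add: cB_def left_diff_distrib sum_subtractf delta_mult
            mult.assoc sum_distrib_left[symmetric])
      then show ?thesis
        using SB[OF that] by (simp add: a'_def)
    qed
    then show "\<forall>(r, x)\<in>B. a' y (r \<odot>\<^bsub>M\<^esub> x) = r \<otimes>\<^bsub>ring_on D\<^esub> a' y x"
      by (auto simp: smult)
  qed
  moreover have "x = (\<Oplus>\<^bsub>M\<^esub>y\<in>S. a' y x \<odot>\<^bsub>M\<^esub> y)" if "x \<in> S0" for x
  proof -
    have "finsum M f T = sum f T" if "finite T" "f \<in> T \<rightarrow> carrier M" for f and T :: "'v set"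
      using that by (induction T rule: finite_induct) (auto simp: add zero)
    moreover have "x \<in> S"
      using that by (simp add: S_def)
    moreover from this have "(\<lambda>y. a' y x \<odot>\<^bsub>M\<^esub> y) \<in> S \<rightarrow> carrier M"
      using a(1) S(2) by (auto simp: a'_def)
    ultimately show ?thesis
      using a(2) S(1) by (simp add: a'_def smult)
  qed
  ultimately show "\<exists>T a. finite T \<and> T \<subseteq> carrier M \<and> (\<forall>j\<in>T. linear_on_pairs (ring_on D) M A B (a j)) \<and>
      (\<forall>x\<in>S0. x = (\<Oplus>\<^bsub>M\<^esub>j\<in>T. a j x \<odot>\<^bsub>M\<^esub> j))"
    using S by blast
qed

end


section \<open>The module of integer-valued rational functions\<close>

lemma rat_eval_0: "rat_defined_at 0 e" "rat_eval 0 e = 0"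
  and rat_eval_1: "rat_defined_at 1 e" "rat_eval 1 e = 1"
  using rat_eval_Fract[of 1 e 0] rat_eval_Fract[of 1 e 1]
  by (auto simp: rat_defined_at_def Zero_fract_def One_fract_def)
    (metis poly_1 zero_neq_one)+

lemma rat_eval_add:
  assumes "rat_defined_at f e" "rat_defined_at g e"
  shows "rat_defined_at (f + g) e" "rat_eval (f + g) e = rat_eval f e + rat_eval g e"
proof -
  obtain p q p' q' where f: "f = Fract p q" "poly q e \<noteq> 0" and g: "g = Fract p' q'" "poly q' e \<noteq> 0"
    using assms by (auto simp: rat_defined_at_def)
  then have "q \<noteq> 0" "q' \<noteq> 0"
    by auto
  then have fg: "f + g = Fract (p * q' + p' * q) (q * q')"
    by (simp add: f g add_fract)
  moreover have "poly (q * q') e \<noteq> 0"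
    using f g by simp
  ultimately show "rat_defined_at (f + g) e"
    unfolding rat_defined_at_def by blast
  show "rat_eval (f + g) e = rat_eval f e + rat_eval g e"
    unfolding fg using f g by (simp add: rat_eval_Fract field_simps)
qed

lemma rat_eval_smult:
  assumes "rat_defined_at f e"
  shows "rat_defined_at (Fract [:d:] 1 * f) e" "rat_eval (Fract [:d:] 1 * f) e = d * rat_eval f e"
proof -
  obtain p q where f: "f = Fract p q" "poly q e \<noteq> 0"
    using assms by (auto simp: rat_defined_at_def)
  then have df: "Fract [:d:] 1 * f = Fract ([:d:] * p) q"
    by simp
  then show "rat_defined_at (Fract [:d:] 1 * f) e"
    unfolding rat_defined_at_def using f by blast
  show "rat_eval (Fract [:d:] 1 * f) e = d * rat_eval f e"
    unfolding df using f by (simp add: rat_eval_Fract)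
qed

lemma vector_space_fract: "vector_space (\<lambda>(d::'k::field) (f::'k poly fract). Fract [:d:] 1 * f)"
proof
  fix c d :: 'k and f g :: "'k poly fract"
  show "Fract [:c + d:] 1 * f = Fract [:c:] 1 * f + Fract [:d:] 1 * f"
    unfolding distrib_right[symmetric] by simp
  show "Fract [:c:] 1 * (Fract [:d:] 1 * f) = Fract [:c * d:] 1 * f"
    unfolding mult.assoc[symmetric] by (simp add: mult.commute)
  show "Fract [:1:] 1 * f = f"
    by (simp add: One_fract_def[symmetric] one_pCons[symmetric])
qed (simp add: distrib_left)

lemma (in prufer) module_int_rat_algebra: "module (ring_on D) (int_rat_algebra E D)"
proof -
  interpret V: vector_space "\<lambda>(d::'k) (f::'k poly fract). Fract [:d:] 1 * f"
    by (rule vector_space_fract)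
  have uminus: "- f \<in> int_rat E D" if "f \<in> int_rat E D" for f
  proof -
    have "- f = Fract [:- 1:] 1 * f"
      using V.scale_minus_left[of 1 f] by (simp add: One_fract_def[symmetric] one_pCons[symmetric])
    then have "rat_defined_at (- f) e \<and> rat_eval (- f) e = - rat_eval f e" if "rat_defined_at f e" for e
      using rat_eval_smult[OF that, of "- 1"] by simp
    then show ?thesis
      using that by (simp add: int_rat_def uminus_mem)
  qed
  show ?thesis
  proof (rule module.intro)
    show "cring (ring_on D)"
      by (rule D.cring_axioms)
    show "abelian_group (int_rat_algebra E D)"
    proof (rule abelian_groupI)
      show "\<exists>g\<in>carrier (int_rat_algebra E D). g \<oplus>\<^bsub>int_rat_algebra E D\<^esub> f = \<zero>\<^bsub>int_rat_algebra E D\<^esub>"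
        if "f \<in> carrier (int_rat_algebra E D)" for f
        using uminus[of f] that by (intro bexI[of _ "- f"]) (simp_all add: int_rat_algebra_def)
    qed (auto simp: int_rat_algebra_def int_rat_def rat_eval_0 rat_eval_add zero_mem add_mem)
    show "module_axioms (ring_on D) (int_rat_algebra E D)"
      by unfold_locales
        (auto simp: int_rat_algebra_def int_rat_def rat_eval_smult mult_mem V.scale_left_distrib
          V.scale_right_distrib V.scale_scale[symmetric] V.scale_one simp del: V.scale_scale mult_fract)
  qed
qed

theorem proposition4p2:
  fixes D E :: "'k::field set"
  assumes "prufer_domain D"
    and "has_quotient_field D"
    and "E \<noteq> {}"
  shows "faithfully_flat TYPE('n1 \<times> 'n2 \<times> 'n3) (ring_on D) (int_rat_algebra E D)"
proof -
  interpret prufer_vector_space D "\<lambda>(d::'k) (f::'k poly fract). Fract [:d:] 1 * f"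
    using assms(1) by (simp add: prufer_vector_space_def prufer_def vector_space_fract)
  obtain e where e: "e \<in> E"
    using assms(3) by blast
  have M: "module (ring_on D) (int_rat_algebra E D)"
    by (rule module_int_rat_algebra)
  show ?thesis
  proof (rule faithfully_flat_if_retract[where a = "\<lambda>f. rat_eval f e" and u = 1])
    show "factors_through_free (ring_on D) (int_rat_algebra E D)"
      by (rule factors_through_free[OF M]) (simp_all add: int_rat_algebra_def)
  qed (use M e one_mem in \<open>auto simp: int_rat_algebra_def int_rat_def rat_eval_add rat_eval_smult
        rat_eval_1\<close>)
qed

end
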